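(* Let $\theta\in[\frac12,1]$ and let $U^n$ be the numerical solution of the full-discrete scheme: $U^0=Q_h\psi$, $U^n\in V_h^0$ and, for $n=1,\dots,N$ and all $v=\{v_0,v_b,v_n\mathbf n_e\}\in V_h^0$, $$(\overline\partial U^n,v_0)+(\Delta_w(\theta U^n+(1-\theta)U^{n-1}),\Delta_w v)=(\theta f(t_n)+(1-\theta)f(t_{n-1}),v_0).$$ Let $\|f(t)\|$ be bounded on $[0,\overline t]$. Then there exists a constant $C>0$ (independent of $h$ and $\tau$) such that $$\|U^n\|\le\|U^0\|+C\sup_{t\in[0,\overline t]}\|f(t)\|,\qquad n=1,\dots,N.$$
   Context: Let $\Omega\subset\mathbb R^d$ ($d=2,3$) be a bounded polygonal/polyhedral domain, $\overline t>0$, $f(t)=f(t,\cdot)\in L^2(\Omega)$ for $t\in[0,\overline t]$, $\psi\in H_0^2(\Omega)$. The time step is $\tau>0$, $t_n=n\tau$, $n=0,\dots,N$, $N\tau=\overline t$, and $\overline\partial U^n:=(U^n-U^{n-1})/\tau$. $(\cdot,\cdot)$, $\|\cdot\|$ denote the $L^2(\Omega)$ inner product and norm (computed elementwise for piecewise functions); for a weak function $v=\{v_0,v_b,v_n\mathbf n_e\}$, $\|v\|:=\|v_0\|$, and a weak function paired with $v_0$ in $(\cdot,\cdot)$ means its interior component. Mesh: $\mathcal T_h$ is a partition of $\Omega$ into polygons/polyhedra $T$ of diameter $h_T$, $h=\max_T h_T$, with edges/faces $\mathcal E_h$, shape regular in the usual weak Galerkin sense with constants independent of $h$: (A1) $|T|\ge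 \varrho_v h_T^d$, $|e|\ge\varrho_e h_e^{d-1}$; (A2) $h_e\ge\kappa h_T$ for $e\subset\partial T$; (A3) for every $T$ and $e\subset\partial T$ there is a pyramid in $T$ with base $e$, apex $A_e\in T$, height at least $\sigma_e h_T$, the angle between $x_e-A_e$ and the outward normal being strictly acute for all $x_e\in e$; (A4) each $T$ has a shape regular circumscribed simplex of diameter at most $\gamma_* h_T$ meeting only a fixed bounded number of other such simplices. For each $e\in\mathcal E_h$ fix one unit normal $\mathbf n_e$; $\mathbf n$ is the outward unit normal of $\partial T$. Spaces: for an integer $k\ge2$, $V_h=\{v=\{v_0,v_b,v_n\mathbf n_e\}: v_0|_T\in P_k(T),\ v_b|_e\in P_k(e),\ v_n|_e\in P_{k-1}(e)\}$ ($v_b,v_n$ single valued on each $e\in\mathcal E_h$), $V_h^0=\{v\in V_h: v_b|_e=0,\ v_n|_e=0 \text{ for } e\subset\partial\Omega\}$. The weak Laplacian $\Delta_w v|_T\in P_r(T)$ is defined by $(\Delta_w v,\varphi)_T=(v_0,\Delta\varphi)_T-\langle v_b,\nabla\varphi\cdot\mathbf n\rangle_{\partial T}+\langle v_n\mathbf n_e\cdot\mathbf n,\varphi\rangle_{\partial T}$ for all $\varphi\in P_r(T)$. The degree $r$ is taken large enough (depending on $k$ and the mesh regularity) that with $|||v|||^2=(\Delta_w v,\Delta_w v)$ and $\|v\|_{2,h}^2=\sum_T(\|\Delta v_0\|_T^2+h_T^{-3}\|v_0-v_b\|_{\partial T}^2+h_T^{-1}\|(\nabla v_0-v_n\mathbf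 n_e)\cdot\mathbf n\|_{\partial T}^2)$ one has $C_1\|v\|_{2,h}\le|||v|||\le C_2\|v\|_{2,h}$ for $v\in V_h$, with $C_1,C_2>0$ independent of $h$. Projections: $Q_0,Q_b,Q_n$ are the $L^2$ projections onto $P_k(T)$, $P_k(e)$, $P_{k-1}(e)$; $Q_hu=\{Q_0u,Q_bu,Q_n(\nabla u\cdot\mathbf n_e)\mathbf n_e\}$. *)

theory Defs
  imports "HOL-Analysis.Analysis"
begin

section \<open>Square integrable functions and $L^2$ projections\<close>

definition L2 :: "'a measure \<Rightarrow> ('a \<Rightarrow> real) set" where
  "L2 M = {g \<in> borel_measurable M. integrable M (\<lambda>x. (g x)\<^sup>2)}"

definition l2_inner :: "'a measure \<Rightarrow> ('a \<Rightarrow> real) \<Rightarrow> ('a \<Rightarrow> real) \<Rightarrow> real" where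
  "l2_inner M f g = (LINT x|M. f x * g x)"

definition l2_norm :: "'a measure \<Rightarrow> ('a \<Rightarrow> real) \<Rightarrow> real" where
  "l2_norm M f = sqrt (l2_inner M f f)"

definition is_L2_proj ::
  "'a measure \<Rightarrow> ('a \<Rightarrow> real) set \<Rightarrow> ('a \<Rightarrow> real) \<Rightarrow> ('a \<Rightarrow> real) \<Rightarrow> bool" where
  "is_L2_proj M S g p \<longleftrightarrow> p \<in> S \<and> (\<forall>q\<in>S. l2_inner M p q = l2_inner M g q)"


section \<open>Derivatives, smooth functions, polynomials\<close>

definition dderiv :: "'a \<Rightarrow> ('a::euclidean_space \<Rightarrow> real) \<Rightarrow> 'a \<Rightarrow> real" where
  "dderiv w f x = frechet_derivative f (at x) w"

fun iter_deriv :: "'a list \<Rightarrow> ('a::euclidean_space \<Rightarrow> real) \<Rightarrow> 'a \<Rightarrow> real" where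
  "iter_deriv [] f = f"
| "iter_deriv (w # ws) f = dderiv w (iter_deriv ws f)"

definition grad :: "('a::euclidean_space \<Rightarrow> real) \<Rightarrow> 'a \<Rightarrow> 'a" where
  "grad f x = (\<Sum>i\<in>Basis. dderiv i f x *\<^sub>R i)"

definition laplacian :: "('a::euclidean_space \<Rightarrow> real) \<Rightarrow> 'a \<Rightarrow> real" where
  "laplacian f x = (\<Sum>i\<in>Basis. iter_deriv [i, i] f x)"

definition smooth_fun :: "('a::euclidean_space \<Rightarrow> real) \<Rightarrow> bool" where
  "smooth_fun f \<longleftrightarrow> (\<forall>ws x. iter_deriv ws f differentiable (at x))"

definition multi_indices :: "nat \<Rightarrow> ('a::euclidean_space \<Rightarrow> nat) set" where
  "multi_indices k = {\<alpha> \<in> Basis \<rightarrow>\<^sub>E UNIV. (\<Sum>i\<in>Basis. \<alpha> i) \<le> k}"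

lemma finite_multi_indices: "finite (multi_indices k)"
proof (rule finite_subset)
  show "multi_indices k \<subseteq> (Basis \<rightarrow>\<^sub>E {..k} :: ('a \<Rightarrow> nat) set)"
  proof
    fix \<alpha> :: "'a \<Rightarrow> nat" assume a: "\<alpha> \<in> multi_indices k"
    have "\<alpha> i \<le> k" if "i \<in> Basis" for i
      using a member_le_sum[of i Basis \<alpha>] that by (force simp: multi_indices_def)
    then show "\<alpha> \<in> Basis \<rightarrow>\<^sub>E {..k}"
      using a by (auto simp: multi_indices_def PiE_iff)
  qed
  show "finite (Basis \<rightarrow>\<^sub>E {..k} :: ('a \<Rightarrow> nat) set)"
    by (intro finite_PiE) auto
qed

text \<open>Polynomial functions of total degree at most \<open>k\<close>. For a mesh element \<open>T\<close> (which has nonempty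
  interior) \<open>P\<^sub>k(T)\<close> is identified with this space; on a flat face only the restriction to the face
  matters, and restrictions of these functions are the polynomials of degree at most \<open>k\<close> in the
  \<open>d - 1\<close> tangential variables.\<close>

definition poly_fun :: "nat \<Rightarrow> ('a::euclidean_space \<Rightarrow> real) set" where
  "poly_fun k = {p. \<exists>c. \<forall>x. p x = (\<Sum>\<alpha>\<in>multi_indices k. c \<alpha> * (\<Prod>i\<in>Basis. (x \<bullet> i) ^ \<alpha> i))}"

definition poly_on :: "nat \<Rightarrow> 'a::euclidean_space set \<Rightarrow> ('a \<Rightarrow> real) set" where
  "poly_on k e = {g. \<exists>p\<in>poly_fun k. \<forall>x\<in>e. g x = p x}"


section \<open>Surface measure on a flat face\<close>

text \<open>For \<open>e\<close> contained in a hyperplane \<open>H = affine hull e\<close>, the \<open>(d - 1)\<close>-dimensional measure on \<open>H\<close>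
  is the image of \<open>d\<close>-dimensional Lebesgue measure on the slab of thickness 1 around \<open>H\<close> under
  orthogonal projection onto \<open>H\<close>.\<close>

definition face_measure :: "'a::euclidean_space set \<Rightarrow> 'a measure" where
  "face_measure e =
     restrict_space
       (distr (restrict_space lborel {x. infdist x (affine hull e) \<le> 1/2}) borel
          (closest_point (affine hull e)))
       e"


section \<open>The space $H^2_0$ and traces of its elements\<close>

definition test_fun :: "'a::euclidean_space set \<Rightarrow> ('a \<Rightarrow> real) \<Rightarrow> bool" where
  "test_fun \<Omega> \<phi> \<longleftrightarrow>
     smooth_fun \<phi> \<and> compact (closure {x. \<phi> x \<noteq> 0}) \<and> closure {x. \<phi> x \<noteq> 0} \<subseteq> \<Omega>"

definition weak_deriv ::
  "'a::euclidean_space set \<Rightarrow> 'a \<Rightarrow> ('a \<Rightarrow> real) \<Rightarrow> ('a \<Rightarrow> real) \<Rightarrow> bool" where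
  "weak_deriv \<Omega> i u w \<longleftrightarrow>
     (\<forall>\<phi>. test_fun \<Omega> \<phi> \<longrightarrow>
        l2_inner (lebesgue_on \<Omega>) u (dderiv i \<phi>) = - l2_inner (lebesgue_on \<Omega>) w \<phi>)"

definition H2_fun ::
  "'a::euclidean_space set \<Rightarrow> ('a \<Rightarrow> real) \<Rightarrow> ('a \<Rightarrow> 'a \<Rightarrow> real) \<Rightarrow> ('a \<Rightarrow> 'a \<Rightarrow> 'a \<Rightarrow> real) \<Rightarrow> bool"
where
  "H2_fun \<Omega> u Du D2u \<longleftrightarrow>
     u \<in> L2 (lebesgue_on \<Omega>) \<and>
     (\<forall>i\<in>Basis. Du i \<in> L2 (lebesgue_on \<Omega>) \<and> weak_deriv \<Omega> i u (Du i)) \<and>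
     (\<forall>i\<in>Basis. \<forall>j\<in>Basis. D2u i j \<in> L2 (lebesgue_on \<Omega>) \<and> weak_deriv \<Omega> j (Du i) (D2u i j))"

text \<open>Convergence of smooth functions \<open>\<phi> n\<close> to \<open>u\<close> in the norm of \<open>H\<^sup>2(\<Omega>)\<close>.\<close>

definition H2_tendsto ::
  "'a::euclidean_space set \<Rightarrow> (nat \<Rightarrow> 'a \<Rightarrow> real) \<Rightarrow> ('a \<Rightarrow> real) \<Rightarrow> bool" where
  "H2_tendsto \<Omega> \<phi> u \<longleftrightarrow>
     (\<exists>Du D2u. H2_fun \<Omega> u Du D2u \<and>
        (\<lambda>n. l2_norm (lebesgue_on \<Omega>) (\<lambda>x. \<phi> n x - u x)) \<longlonglongrightarrow> 0 \<and>
        (\<forall>i\<in>Basis. (\<lambda>n. l2_norm (lebesgue_on \<Omega>) (\<lambda>x. dderiv i (\<phi> n) x - Du i x)) \<longlonglongrightarrow> 0) \<and>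
        (\<forall>i\<in>Basis. \<forall>j\<in>Basis.
           (\<lambda>n. l2_norm (lebesgue_on \<Omega>) (\<lambda>x. iter_deriv [j, i] (\<phi> n) x - D2u i j x)) \<longlonglongrightarrow> 0))"

definition H02 :: "'a::euclidean_space set \<Rightarrow> ('a \<Rightarrow> real) set" where
  "H02 \<Omega> = {u. \<exists>\<phi>. (\<forall>n. test_fun \<Omega> (\<phi> n)) \<and> H2_tendsto \<Omega> \<phi> u}"

text \<open>Traces on a face \<open>e\<close> are only needed for elements of \<open>H\<^sup>2\<^sub>0(\<Omega>)\<close>, where the trace operator (and
  the trace of a directional derivative) is the continuous extension, from the dense subspace of
  test functions, of restriction to \<open>e\<close>. In \<open>is_trace \<Omega> e ws u g\<close> the function \<open>g\<close> is the trace
  on \<open>e\<close> of the iterated derivative of \<open>u\<close> in the directions \<open>ws\<close>; here \<open>ws\<close> has length at most 1.\<close>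

definition is_trace ::
  "'a::euclidean_space set \<Rightarrow> 'a set \<Rightarrow> 'a list \<Rightarrow> ('a \<Rightarrow> real) \<Rightarrow> ('a \<Rightarrow> real) \<Rightarrow> bool" where
  "is_trace \<Omega> e ws u g \<longleftrightarrow>
     g \<in> L2 (face_measure e) \<and>
     (\<exists>\<phi>. (\<forall>n. test_fun \<Omega> (\<phi> n)) \<and> H2_tendsto \<Omega> \<phi> u \<and>
        (\<lambda>n. l2_norm (face_measure e) (\<lambda>x. iter_deriv ws (\<phi> n) x - g x)) \<longlonglongrightarrow> 0)"


section \<open>Polygonal and polyhedral meshes\<close>

text \<open>\<open>polytope\<close> means convex polytope in the library; domains, elements and faces need not be convex.\<close>

definition polyhedral_set :: "'a::euclidean_space set \<Rightarrow> bool" where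
  "polyhedral_set K \<longleftrightarrow> (\<exists>P. finite P \<and> (\<forall>p\<in>P. polytope p) \<and> K = \<Union>P)"

definition polyhedral_domain :: "'a::euclidean_space set \<Rightarrow> bool" where
  "polyhedral_domain \<Omega> \<longleftrightarrow>
     open \<Omega> \<and> connected \<Omega> \<and> \<Omega> \<noteq> {} \<and> bounded \<Omega> \<and>
     polyhedral_set (closure \<Omega>) \<and> interior (closure \<Omega>) = \<Omega>"

definition polyhedral_element :: "'a::euclidean_space set \<Rightarrow> bool" where
  "polyhedral_element T \<longleftrightarrow>
     polyhedral_set T \<and> interior T \<noteq> {} \<and> connected (interior T) \<and> closure (interior T) = T"

definition flat_face :: "'a::euclidean_space set \<Rightarrow> bool" where
  "flat_face e \<longleftrightarrow>
     polyhedral_set e \<and> aff_dim e = int DIM('a) - 1 \<and>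
     connected (rel_interior e) \<and> closure (rel_interior e) = e"

definition unit_normal_to :: "'a::euclidean_space set \<Rightarrow> 'a \<Rightarrow> bool" where
  "unit_normal_to e \<nu> \<longleftrightarrow> norm \<nu> = 1 \<and> (\<forall>x\<in>e. \<forall>y\<in>e. (x - y) \<bullet> \<nu> = 0)"

definition is_outward_normal :: "'a::euclidean_space set \<Rightarrow> 'a set \<Rightarrow> 'a \<Rightarrow> bool" where
  "is_outward_normal T e \<nu> \<longleftrightarrow>
     unit_normal_to e \<nu> \<and>
     (\<forall>x\<in>rel_interior e. \<forall>\<^sub>F s in at_right 0.
        x - s *\<^sub>R \<nu> \<in> interior T \<and> x + s *\<^sub>R \<nu> \<notin> T)"

definition outward_normal :: "'a::euclidean_space set \<Rightarrow> 'a set \<Rightarrow> 'a" where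
  "outward_normal T e = (THE \<nu>. is_outward_normal T e \<nu>)"

text \<open>A mesh consists of the closed elements, the closed edges/faces, and the fixed unit normal of
  each edge/face.\<close>

record 'a mesh =
  elems :: "'a set set"
  faces :: "'a set set"
  fnormal :: "'a set \<Rightarrow> 'a"

definition faces_of :: "'a::euclidean_space mesh \<Rightarrow> 'a set \<Rightarrow> 'a set set" where
  "faces_of m T = {e \<in> faces m. e \<subseteq> frontier T}"

text \<open>No conformity is imposed on the elements: with hanging nodes, a flat piece of the boundary of
  \<open>T\<close> is just subdivided into several faces.\<close>

definition polyhedral_mesh :: "'a::euclidean_space set \<Rightarrow> 'a mesh \<Rightarrow> bool" where
  "polyhedral_mesh \<Omega> m \<longleftrightarrow>
     finite (elems m) \<and> \<Union>(elems m) = closure \<Omega> \<and>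
     (\<forall>T\<in>elems m. polyhedral_element T) \<and>
     (\<forall>T\<in>elems m. \<forall>T'\<in>elems m. T \<noteq> T' \<longrightarrow> interior T \<inter> interior T' = {}) \<and>
     finite (faces m) \<and>
     (\<forall>e\<in>faces m. flat_face e \<and> unit_normal_to e (fnormal m e) \<and>
        (\<exists>T\<in>elems m. e \<subseteq> frontier T)) \<and>
     (\<forall>e\<in>faces m. \<forall>e'\<in>faces m. e \<noteq> e' \<longrightarrow> rel_interior e \<inter> rel_interior e' = {}) \<and>
     (\<forall>T\<in>elems m. frontier T = \<Union>(faces_of m T) \<and>
        (\<forall>e\<in>faces_of m T. \<exists>\<nu>. is_outward_normal T e \<nu>))"

text \<open>Shape regularity, conditions (A1)--(A4). In (A3) the pyramid with base \<open>e\<close> and apex \<open>A\<close> is the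
  union of the segments from \<open>A\<close> to the points of \<open>e\<close>, and \<open>(x - A) \<bullet> n\<close> is its height for every
  \<open>x \<in> e\<close>. In (A4), \<open>\<eta>\<close> bounds below the ratio of the radius of an inscribed ball of the circumscribed
  simplex \<open>S T\<close> to its diameter, and \<open>L\<close> bounds the number of neighbours of \<open>S T\<close>.\<close>

definition shape_regular ::
  "real \<Rightarrow> real \<Rightarrow> real \<Rightarrow> real \<Rightarrow> real \<Rightarrow> real \<Rightarrow> nat \<Rightarrow> 'a::euclidean_space mesh \<Rightarrow> bool" where
  "shape_regular \<rho>v \<rho>e \<kappa> \<sigma> \<gamma> \<eta> L m \<longleftrightarrow>
     (\<forall>T\<in>elems m. measure lebesgue T \<ge> \<rho>v * diameter T ^ DIM('a)) \<and>
     (\<forall>e\<in>faces m. measure (face_measure e) e \<ge> \<rho>e * diameter e ^ (DIM('a) - 1)) \<and>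
     (\<forall>T\<in>elems m. \<forall>e\<in>faces_of m T. diameter e \<ge> \<kappa> * diameter T) \<and>
     (\<forall>T\<in>elems m. \<forall>e\<in>faces_of m T. \<exists>A\<in>T.
        (\<Union>x\<in>e. closed_segment A x) \<subseteq> T \<and>
        (\<forall>x\<in>e. (x - A) \<bullet> outward_normal T e \<ge> \<sigma> * diameter T \<and>
               (x - A) \<bullet> outward_normal T e > 0)) \<and>
     (\<exists>S. \<forall>T\<in>elems m.
        int DIM('a) simplex S T \<and> T \<subseteq> S T \<and> diameter (S T) \<le> \<gamma> * diameter T \<and>
        (\<exists>x. cball x (\<eta> * diameter (S T)) \<subseteq> S T) \<and>
        card {T' \<in> elems m. T' \<noteq> T \<and> S T' \<inter> S T \<noteq> {}} \<le> L)"


section \<open>Weak functions\<close>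

text \<open>The components of a weak function are indexed by elements and faces: \<open>v0 v T\<close> is the interior
  component on the element \<open>T\<close>; \<open>vb v e\<close> and \<open>vn v e\<close> are the components on the face \<open>e\<close>
  (hence single valued). The third component of the weak function is the vector field
  \<open>vn v e x *\<^sub>R fnormal m e\<close>.\<close>

datatype 'a weak_fun =
  Weak_Fun (v0: "'a set \<Rightarrow> 'a \<Rightarrow> real") (vb: "'a set \<Rightarrow> 'a \<Rightarrow> real") (vn: "'a set \<Rightarrow> 'a \<Rightarrow> real")

instantiation weak_fun :: (type) real_vector
begin

definition zero_weak_fun :: "'a weak_fun" where
  "0 = Weak_Fun (\<lambda>_ _. 0) (\<lambda>_ _. 0) (\<lambda>_ _. 0)"

definition plus_weak_fun :: "'a weak_fun \<Rightarrow> 'a weak_fun \<Rightarrow> 'a weak_fun" where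
  "v + w = Weak_Fun (\<lambda>T x. v0 v T x + v0 w T x) (\<lambda>e x. vb v e x + vb w e x)
                    (\<lambda>e x. vn v e x + vn w e x)"

definition uminus_weak_fun :: "'a weak_fun \<Rightarrow> 'a weak_fun" where
  "- v = Weak_Fun (\<lambda>T x. - v0 v T x) (\<lambda>e x. - vb v e x) (\<lambda>e x. - vn v e x)"

definition minus_weak_fun :: "'a weak_fun \<Rightarrow> 'a weak_fun \<Rightarrow> 'a weak_fun" where
  "v - w = Weak_Fun (\<lambda>T x. v0 v T x - v0 w T x) (\<lambda>e x. vb v e x - vb w e x)
                    (\<lambda>e x. vn v e x - vn w e x)"

definition scaleR_weak_fun :: "real \<Rightarrow> 'a weak_fun \<Rightarrow> 'a weak_fun" where
  "c *\<^sub>R v = Weak_Fun (\<lambda>T x. c * v0 v T x) (\<lambda>e x. c * vb v e x) (\<lambda>e x. c * vn v e x)"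

instance
  by standard
    (auto simp: zero_weak_fun_def plus_weak_fun_def uminus_weak_fun_def minus_weak_fun_def
       scaleR_weak_fun_def algebra_simps)

end

definition Vh :: "'a::euclidean_space mesh \<Rightarrow> nat \<Rightarrow> 'a weak_fun set" where
  "Vh m k = {v. (\<forall>T\<in>elems m. v0 v T \<in> poly_fun k) \<and>
                (\<forall>e\<in>faces m. vb v e \<in> poly_on k e \<and> vn v e \<in> poly_on (k - 1) e)}"

definition Vh0 :: "'a::euclidean_space set \<Rightarrow> 'a mesh \<Rightarrow> nat \<Rightarrow> 'a weak_fun set" where
  "Vh0 \<Omega> m k = {v \<in> Vh m k. \<forall>e\<in>faces m. e \<subseteq> frontier \<Omega> \<longrightarrow> (\<forall>x\<in>e. vb v e x = 0 \<and> vn v e x = 0)}"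

text \<open>\<open>L\<^sup>2(\<Omega>)\<close> inner product of elementwise given functions.\<close>

definition mesh_inner ::
  "'a::euclidean_space mesh \<Rightarrow> ('a set \<Rightarrow> 'a \<Rightarrow> real) \<Rightarrow> ('a set \<Rightarrow> 'a \<Rightarrow> real) \<Rightarrow> real" where
  "mesh_inner m F G = (\<Sum>T\<in>elems m. l2_inner (lebesgue_on T) (F T) (G T))"

definition weak_norm :: "'a::euclidean_space mesh \<Rightarrow> 'a weak_fun \<Rightarrow> real" where
  "weak_norm m v = sqrt (mesh_inner m (v0 v) (v0 v))"

definition weak_laplacian ::
  "'a::euclidean_space mesh \<Rightarrow> nat \<Rightarrow> 'a weak_fun \<Rightarrow> 'a set \<Rightarrow> 'a \<Rightarrow> real" where
  "weak_laplacian m r v T =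
     (THE w. w \<in> poly_fun r \<and> (\<forall>\<phi>\<in>poly_fun r.
        l2_inner (lebesgue_on T) w \<phi> =
          l2_inner (lebesgue_on T) (v0 v T) (laplacian \<phi>)
          - (\<Sum>e\<in>faces_of m T.
               l2_inner (face_measure e) (vb v e) (\<lambda>x. grad \<phi> x \<bullet> outward_normal T e))
          + (\<Sum>e\<in>faces_of m T.
               l2_inner (face_measure e)
                 (\<lambda>x. (vn v e x *\<^sub>R fnormal m e) \<bullet> outward_normal T e) \<phi>)))"

definition triple_norm :: "'a::euclidean_space mesh \<Rightarrow> nat \<Rightarrow> 'a weak_fun \<Rightarrow> real" where
  "triple_norm m r v = sqrt (mesh_inner m (weak_laplacian m r v) (weak_laplacian m r v))"

definition norm_2h :: "'a::euclidean_space mesh \<Rightarrow> 'a weak_fun \<Rightarrow> real" where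
  "norm_2h m v =
     sqrt (\<Sum>T\<in>elems m.
       (l2_norm (lebesgue_on T) (laplacian (v0 v T)))\<^sup>2
       + (\<Sum>e\<in>faces_of m T. (l2_norm (face_measure e) (\<lambda>x. v0 v T x - vb v e x))\<^sup>2)
           / diameter T ^ 3
       + (\<Sum>e\<in>faces_of m T.
            (l2_norm (face_measure e)
               (\<lambda>x. (grad (v0 v T) x - vn v e x *\<^sub>R fnormal m e) \<bullet> outward_normal T e))\<^sup>2)
           / diameter T)"

text \<open>\<open>r\<close> is large enough for the norms above to be equivalent on \<open>Vh m k\<close> with constants
  \<open>C1\<close>, \<open>C2\<close>.\<close>

definition norm_equivalence ::
  "real \<Rightarrow> real \<Rightarrow> nat \<Rightarrow> nat \<Rightarrow> 'a::euclidean_space mesh \<Rightarrow> bool" where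
  "norm_equivalence C1 C2 k r m \<longleftrightarrow>
     (\<forall>v\<in>Vh m k. C1 * norm_2h m v \<le> triple_norm m r v \<and> triple_norm m r v \<le> C2 * norm_2h m v)"

text \<open>\<open>is_Qh \<Omega> m k u w\<close>: the weak function \<open>w\<close> is \<open>Q\<^sub>h u\<close>, for \<open>u \<in> H\<^sup>2\<^sub>0(\<Omega>)\<close>. This is a relation
  because traces are only determined almost everywhere on a face.\<close>

definition is_Qh ::
  "'a::euclidean_space set \<Rightarrow> 'a mesh \<Rightarrow> nat \<Rightarrow> ('a \<Rightarrow> real) \<Rightarrow> 'a weak_fun \<Rightarrow> bool" where
  "is_Qh \<Omega> m k u w \<longleftrightarrow>
     (\<forall>T\<in>elems m. is_L2_proj (lebesgue_on T) (poly_fun k) u (v0 w T)) \<and>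
     (\<forall>e\<in>faces m.
        (\<exists>g. is_trace \<Omega> e [] u g \<and> is_L2_proj (face_measure e) (poly_on k e) g (vb w e)) \<and>
        (\<exists>g. is_trace \<Omega> e [fnormal m e] u g \<and>
             is_L2_proj (face_measure e) (poly_on (k - 1) e) g (vn w e)))"


section \<open>The fully discrete scheme\<close>

definition backward_diff :: "real \<Rightarrow> (nat \<Rightarrow> 'a weak_fun) \<Rightarrow> nat \<Rightarrow> 'a weak_fun" where
  "backward_diff \<tau> U n = (1 / \<tau>) *\<^sub>R (U n - U (n - 1))"

definition theta_scheme ::
  "'a::euclidean_space set \<Rightarrow> 'a mesh \<Rightarrow> nat \<Rightarrow> nat \<Rightarrow> real \<Rightarrow> real \<Rightarrow> nat \<Rightarrow>
    (real \<Rightarrow> 'a \<Rightarrow> real) \<Rightarrow> ('a \<Rightarrow> real) \<Rightarrow> (nat \<Rightarrow> 'a weak_fun) \<Rightarrow> bool" where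
  "theta_scheme \<Omega> m k r \<theta> \<tau> N f \<psi> U \<longleftrightarrow>
     is_Qh \<Omega> m k \<psi> (U 0) \<and>
     (\<forall>n\<in>{1..N}. U n \<in> Vh0 \<Omega> m k \<and>
        (\<forall>v\<in>Vh0 \<Omega> m k.
           mesh_inner m (v0 (backward_diff \<tau> U n)) (v0 v)
           + mesh_inner m (weak_laplacian m r (\<theta> *\<^sub>R U n + (1 - \<theta>) *\<^sub>R U (n - 1)))
                          (weak_laplacian m r v)
           = mesh_inner m
               (\<lambda>T x. \<theta> * f (real n * \<tau>) x + (1 - \<theta>) * f (real (n - 1) * \<tau>) x) (v0 v)))"

end

theory Submission
  imports Defs
begin

text \<open>Stability comes from testing the scheme with the average \<open>W = \<theta> U\<^sup>n + (1 - \<theta>) U\<^sup>n\<^sup>-\<^sup>1\<close> that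
  the scheme itself evaluates. The stiffness term becomes \<open>(\<Delta>\<^sub>w W, \<Delta>\<^sub>w W) \<ge> 0\<close> and can be dropped,
  which leaves \<open>(U\<^sup>n - U\<^sup>n\<^sup>-\<^sup>1, W) \<le> \<tau> (F, W)\<close>, where \<open>F\<close> is the averaged right-hand side. Write \<open>a\<close>, \<open>b\<close>
  for the norms of \<open>U\<^sup>n\<close>, \<open>U\<^sup>n\<^sup>-\<^sup>1\<close>. The cross term of the left-hand side has the coefficient
  \<open>1 - 2\<theta> \<le> 0\<close>, so Cauchy--Schwarz bounds it in the useful direction and the left-hand side is at
  least \<open>\<theta> a\<^sup>2 - (2\<theta> - 1) a b - (1 - \<theta>) b\<^sup>2 = (a - b) (\<theta> a + (1 - \<theta>) b)\<close>; the right-hand side is at most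
  \<open>\<tau> M (\<theta> a + (1 - \<theta>) b)\<close> with \<open>M = sup \<parallel>f\<parallel>\<close>. Cancelling the common factor gives \<open>a \<le> b + \<tau> M\<close>
  (\<open>theta_step\<close>). Summing over the steps yields the claim with the final time \<open>tbar\<close> as constant
  (\<open>theta_scheme_stable\<close>).

  Two points need care. In the first step \<open>W\<close> contains \<open>U\<^sup>0 = Q\<^sub>h \<psi>\<close>, whose boundary components are
  projections of traces and so are known to vanish only almost everywhere, whereas test functions
  have boundary components that vanish at every point. Resetting these components to zero gives an
  admissible test function with the same interior component and the same weak Laplacian, because
  the latter sees the boundary components only through integrals (\<open>weak_laplacian_reset_boundary\<close>).
  That the traces vanish follows from their approximation by functions supported inside the domain
  (\<open>boundary_trace_AE_zero\<close>). Secondly, the scheme pairs \<open>f\<close> with test functions element by element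
  over closed elements, which overlap and stick out of the open domain; \<open>L2_restrict_mesh\<close> compares
  the resulting norm with that of \<open>L\<^sup>2(\<Omega>)\<close>, using that the boundary of an element is a null set.\<close>

section \<open>Square integrable functions\<close>

lemma L2_integrable_mult:
  assumes "f \<in> L2 M" "g \<in> L2 M"
  shows "integrable M (\<lambda>x. f x * g x)"
proof (rule Bochner_Integration.integrable_bound)
  show "integrable M (\<lambda>x. (f x)\<^sup>2 + (g x)\<^sup>2)"
    using assms by (simp add: L2_def)
  show "(\<lambda>x. f x * g x) \<in> borel_measurable M"
    using assms by (auto simp: L2_def intro: borel_measurable_times)
  have "\<bar>a * b\<bar> \<le> a\<^sup>2 + b\<^sup>2" for a b :: real
    using sum_squares_bound[of "\<bar>a\<bar>" "\<bar>b\<bar>"] mult_nonneg_nonneg[of "\<bar>a\<bar>" "\<bar>b\<bar>"]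
    by (simp only: abs_mult power2_abs) linarith
  then show "AE x in M. norm (f x * g x) \<le> norm ((f x)\<^sup>2 + (g x)\<^sup>2)"
    by auto
qed

lemma L2_add:
  assumes "f \<in> L2 M" "g \<in> L2 M"
  shows "(\<lambda>x. f x + g x) \<in> L2 M"
  using assms L2_integrable_mult[OF assms]
  by (auto simp: L2_def power2_sum mult.assoc)

lemma L2_scale:
  assumes "f \<in> L2 M"
  shows "(\<lambda>x. c * f x) \<in> L2 M"
  using assms by (auto simp: L2_def power_mult_distrib)

lemma L2_bounded:
  assumes "finite_measure M" "f \<in> borel_measurable M" "\<And>x. x \<in> space M \<Longrightarrow> \<bar>f x\<bar> \<le> B"
  shows "f \<in> L2 M"
proof -
  interpret finite_measure M by fact
  have "(f x)\<^sup>2 \<le> B\<^sup>2" if "x \<in> space M" for x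
    using assms(3)[OF that] abs_le_square_iff[of "f x" B] by auto
  then have "integrable M (\<lambda>x. (f x)\<^sup>2)"
    using assms(2) by (intro integrable_const_bound[where B = "B\<^sup>2"]) auto
  then show ?thesis using assms(2) by (simp add: L2_def)
qed

lemma AE_zero_if_l2_inner_self_zero:
  assumes "p \<in> L2 M" "l2_inner M p p = 0"
  shows "AE x in M. p x = 0"
proof -
  have "AE x in M. p x * p x = 0"
    using assms integral_nonneg_eq_0_iff_AE[of M "\<lambda>x. p x * p x"] L2_integrable_mult[of p M p]
    by (auto simp: l2_inner_def)
  then show ?thesis by simp
qed

text \<open>Orthogonality of the projection error, tested with the projection \<open>p\<close> itself, gives
  \<open>(p, p) = (g, p) = 0\<close>.\<close>

lemma L2_proj_AE_zero:
  assumes "is_L2_proj M S g p" "p \<in> L2 M" "g \<in> L2 M" "AE x in M. g x = 0"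
  shows "AE x in M. p x = 0"
proof -
  have "l2_inner M p p = l2_inner M g p"
    using assms(1) by (simp add: is_L2_proj_def)
  also have "\<dots> = (LINT x|M. 0)"
    unfolding l2_inner_def using assms(2-4) by (intro integral_cong_AE) (auto simp: L2_def)
  finally show ?thesis
    using assms(2) by (intro AE_zero_if_l2_inner_self_zero) auto
qed

lemma l2_inner_AE_zero:
  assumes "AE x in M. f x = 0" "f \<in> borel_measurable M"
  shows "l2_inner M f g = 0"
proof -
  have "AE x in M. f x * g x = 0"
    using assms(1) by eventually_elim simp
  then show ?thesis
    unfolding l2_inner_def by (rule integral_eq_zero_AE)
qed

section \<open>Polynomials\<close>

lemma poly_fun_add:
  assumes "p \<in> poly_fun k" "q \<in> poly_fun k"
  shows "(\<lambda>x. p x + q x) \<in> poly_fun k"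
proof -
  obtain c d where
    "\<And>x. p x = (\<Sum>\<alpha>\<in>multi_indices k. c \<alpha> * (\<Prod>i\<in>Basis. (x \<bullet> i) ^ \<alpha> i))"
    "\<And>x. q x = (\<Sum>\<alpha>\<in>multi_indices k. d \<alpha> * (\<Prod>i\<in>Basis. (x \<bullet> i) ^ \<alpha> i))"
    using assms by (auto simp: poly_fun_def)
  then show ?thesis
    unfolding poly_fun_def
    by (auto intro!: exI[of _ "\<lambda>\<alpha>. c \<alpha> + d \<alpha>"] simp: distrib_right sum.distrib)
qed

lemma poly_fun_scale:
  assumes "p \<in> poly_fun k"
  shows "(\<lambda>x. a * p x) \<in> poly_fun k"
proof -
  obtain c where
    "\<And>x. p x = (\<Sum>\<alpha>\<in>multi_indices k. c \<alpha> * (\<Prod>i\<in>Basis. (x \<bullet> i) ^ \<alpha> i))"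
    using assms by (auto simp: poly_fun_def)
  then show ?thesis
    unfolding poly_fun_def
    by (auto intro!: exI[of _ "\<lambda>\<alpha>. a * c \<alpha>"] simp: sum_distrib_left mult.assoc)
qed

lemma poly_on_add:
  assumes "p \<in> poly_on k e" "q \<in> poly_on k e"
  shows "(\<lambda>x. p x + q x) \<in> poly_on k e"
proof -
  obtain p' q' where "p' \<in> poly_fun k" "q' \<in> poly_fun k"
    "\<forall>x\<in>e. p x = p' x" "\<forall>x\<in>e. q x = q' x"
    using assms by (auto simp: poly_on_def)
  then show ?thesis
    using poly_fun_add[of p' k q'] by (auto simp: poly_on_def intro!: bexI[of _ "\<lambda>x. p' x + q' x"])
qed

lemma poly_on_scale:
  assumes "p \<in> poly_on k e"
  shows "(\<lambda>x. a * p x) \<in> poly_on k e"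
proof -
  obtain p' where "p' \<in> poly_fun k" "\<forall>x\<in>e. p x = p' x"
    using assms by (auto simp: poly_on_def)
  then show ?thesis
    using poly_fun_scale[of p' k a] by (auto simp: poly_on_def intro!: bexI[of _ "\<lambda>x. a * p' x"])
qed

lemma zero_poly_on: "(\<lambda>x. 0) \<in> poly_on k e"
proof -
  have "(\<lambda>x. 0) \<in> poly_fun k"
    unfolding poly_fun_def by (auto intro!: exI[of _ "\<lambda>_. 0"])
  then show ?thesis by (force simp: poly_on_def)
qed

lemma continuous_on_poly_fun:
  assumes "p \<in> poly_fun k"
  shows "continuous_on A p"
proof -
  obtain c where
    "p = (\<lambda>x. \<Sum>\<alpha>\<in>multi_indices k. c \<alpha> * (\<Prod>i\<in>Basis. (x \<bullet> i) ^ \<alpha> i))"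
    using assms by (auto simp: poly_fun_def)
  then show ?thesis
    by (simp only:) (intro continuous_intros)
qed

lemma poly_fun_bounded:
  fixes K :: "'a::euclidean_space set"
  assumes "p \<in> poly_fun k" "compact K"
  obtains B where "\<And>x. x \<in> K \<Longrightarrow> \<bar>p x\<bar> \<le> B"
proof -
  have "bounded (p ` K)"
    by (intro compact_imp_bounded compact_continuous_image continuous_on_poly_fun assms)
       (rule assms)
  then show ?thesis using that by (auto simp: bounded_iff)
qed

lemma poly_fun_in_L2:
  fixes T :: "'a::euclidean_space set"
  assumes "p \<in> poly_fun k" "compact T"
  shows "p \<in> L2 (lebesgue_on T)"
proof -
  obtain B where B: "\<And>x. x \<in> T \<Longrightarrow> \<bar>p x\<bar> \<le> B"
    using poly_fun_bounded[OF assms] by blast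
  have "finite_measure (lebesgue_on T)"
    by (intro finite_measure_lebesgue_on lmeasurable_compact assms)
  moreover have "p \<in> borel_measurable (lebesgue_on T)"
    using assms by (intro continuous_imp_measurable_on_sets_lebesgue continuous_on_poly_fun
        lmeasurable_compact fmeasurableD)
  ultimately show ?thesis
    by (rule L2_bounded) (use B in auto)
qed

section \<open>Polyhedral sets\<close>

lemma compact_polyhedral_set: "polyhedral_set K \<Longrightarrow> compact K"
  unfolding polyhedral_set_def by (metis compact_Union polytope_imp_compact)

text \<open>The boundary of a finite union lies in the union of the boundaries of the convex
  pieces.\<close>

lemma negligible_frontier_polyhedral_set:
  assumes "polyhedral_set K"
  shows "negligible (frontier K)"
proof -
  obtain P where P: "finite P" "\<And>p. p \<in> P \<Longrightarrow> polytope p" "K = \<Union>P"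
    using assms by (auto simp: polyhedral_set_def)
  have "negligible (\<Union>p\<in>P. frontier p)"
    using P by (intro negligible_Union) (auto intro!: negligible_convex_frontier polytope_imp_convex)
  moreover have "frontier K \<subseteq> (\<Union>p\<in>P. frontier p)"
    using frontier_Union_subset[of P] P by auto
  ultimately show ?thesis by (rule negligible_subset)
qed

section \<open>Surface measure\<close>

lemma space_face_measure: "space (face_measure e) = e"
  by (simp add: face_measure_def space_restrict_space)

lemma borel_measurable_face_measure:
  assumes "continuous_on UNIV p"
  shows "(p :: 'a::euclidean_space \<Rightarrow> real) \<in> borel_measurable (face_measure e)"
proof -
  have "p \<in> borel_measurable borel"
    using assms by (rule borel_measurable_continuous_onI)
  then show ?thesis
    unfolding face_measure_def by (intro measurable_restrict_space1) simp
qed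

text \<open>The surface measure of \<open>e\<close> is the volume of the points of the slab that project into \<open>e\<close>;
  these lie within distance \<open>1/2\<close> of the bounded set \<open>e\<close>.\<close>

lemma finite_face_measure:
  fixes e :: "'a::euclidean_space set"
  assumes "compact e"
  shows "finite_measure (face_measure e)"
proof (cases "e = {}")
  case True
  then have "emeasure (face_measure e) (space (face_measure e)) = emeasure (face_measure e) {}"
    by (simp add: space_face_measure)
  then show ?thesis
    by (intro finite_measureI) simp
next
  case False
  let ?H = "affine hull e"
  let ?c = "closest_point ?H"
  let ?S = "{x. infdist x ?H \<le> 1/2}"
  have H: "convex ?H" "closed ?H" "?H \<noteq> {}"
    using False by (auto simp: affine_imp_convex)
  have "closed ?S"
    by (intro closed_Collect_le continuous_intros)
  then have S: "?S \<in> sets lborel" by simp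
  have e: "e \<in> sets borel"
    using assms by (simp add: compact_imp_closed)
  have c: "?c \<in> borel_measurable borel"
    by (intro borel_measurable_continuous_onI continuous_on_closest_point H)
  then have c': "?c \<in> measurable (restrict_space lborel ?S) borel"
    by (intro measurable_restrict_space1) simp
  have pre: "?c -` e \<inter> ?S \<in> sets lborel"
    using measurable_sets[OF c e] S by simp
  have "bounded (?c -` e \<inter> ?S)"
  proof -
    obtain R where R: "\<And>x. x \<in> e \<Longrightarrow> norm x \<le> R"
      using assms compact_imp_bounded bounded_iff by metis
    have "norm x \<le> R + 1" if "?c x \<in> e" "infdist x ?H \<le> 1/2" for x
    proof -
      have "dist x (?c x) = infdist x ?H"
        using setdist_closest_point[of ?H x] H infdist_eq_setdist[of x ?H] by simp
      then show ?thesis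
        using that R[OF that(1)] norm_triangle_sub[of x "?c x"] by (simp add: dist_norm)
    qed
    then show ?thesis by (auto simp: bounded_iff intro!: exI[of _ "R + 1"])
  qed
  then have "emeasure lborel (?c -` e \<inter> ?S) < \<infinity>"
    by (rule emeasure_bounded_finite)
  moreover have "emeasure (face_measure e) (space (face_measure e)) = emeasure lborel (?c -` e \<inter> ?S)"
    using e c' S pre unfolding space_face_measure
    by (simp add: face_measure_def emeasure_restrict_space emeasure_distr space_restrict_space)
  ultimately show ?thesis
    by (intro finite_measureI) auto
qed

lemma poly_on_in_L2:
  fixes e :: "'a::euclidean_space set"
  assumes "p \<in> poly_on k e" "compact e"
  shows "p \<in> L2 (face_measure e)"
proof -
  obtain q where q: "q \<in> poly_fun k" "\<And>x. x \<in> e \<Longrightarrow> p x = q x"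
    using assms by (auto simp: poly_on_def)
  obtain B where B: "\<And>x. x \<in> e \<Longrightarrow> \<bar>q x\<bar> \<le> B"
    using poly_fun_bounded[OF q(1) assms(2)] by blast
  have "q \<in> borel_measurable (face_measure e)"
    by (intro borel_measurable_face_measure continuous_on_poly_fun[OF q(1)])
  then have "p \<in> borel_measurable (face_measure e)"
    using q(2) by (subst measurable_cong[where g = q]) (auto simp: space_face_measure)
  then show ?thesis
    using L2_bounded[OF finite_face_measure[OF assms(2)], of p B] B q(2)
    by (auto simp: space_face_measure)
qed

section \<open>Traces of functions with vanishing boundary values\<close>

lemma iter_deriv_zero_on_open:
  fixes f :: "'a::euclidean_space \<Rightarrow> real"
  assumes "open A" "\<And>x. x \<in> A \<Longrightarrow> f x = 0" "x \<in> A"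
  shows "iter_deriv ws f x = 0"
  using assms(3)
proof (induction ws arbitrary: x)
  case Nil
  then show ?case by (simp add: assms(2))
next
  case (Cons w ws)
  have "(iter_deriv ws f has_derivative (\<lambda>_. 0)) (at x)"
    by (rule has_derivative_transform_within_open[OF has_derivative_const[of 0] assms(1) Cons.prems])
       (simp add: Cons.IH)
  then show ?case
    by (simp add: dderiv_def frechet_derivative_at[symmetric])
qed

text \<open>Test functions vanish near every boundary point of the domain, so on a boundary face the
  approximating sequence of the trace is the zero sequence. This covers the trace of a function as
  well as that of its normal derivative.\<close>

lemma boundary_trace_AE_zero:
  fixes \<Omega> :: "'a::euclidean_space set"
  assumes "is_trace \<Omega> e ws u g" "open \<Omega>" "e \<subseteq> frontier \<Omega>"
  shows "AE x in face_measure e. g x = 0"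
proof -
  obtain \<phi> where g: "g \<in> L2 (face_measure e)" and \<phi>: "\<And>n. test_fun \<Omega> (\<phi> n)"
    and lim: "(\<lambda>n. l2_norm (face_measure e) (\<lambda>x. iter_deriv ws (\<phi> n) x - g x)) \<longlonglongrightarrow> 0"
    using assms(1) by (auto simp: is_trace_def)
  have "iter_deriv ws (\<phi> n) x = 0" if "x \<in> e" for n x
  proof (rule iter_deriv_zero_on_open)
    show "open (- closure {x. \<phi> n x \<noteq> 0})" by (intro open_Compl closed_closure)
    show "x \<in> - closure {x. \<phi> n x \<noteq> 0}"
      using that assms(2,3) \<phi>[of n] by (auto simp: test_fun_def frontier_def interior_open)
    show "\<phi> n y = 0" if "y \<in> - closure {x. \<phi> n x \<noteq> 0}" for y
      using that closure_subset[of "{x. \<phi> n x \<noteq> 0}"] by auto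
  qed
  then have "l2_norm (face_measure e) (\<lambda>x. iter_deriv ws (\<phi> n) x - g x) = l2_norm (face_measure e) g"
    for n
    unfolding l2_norm_def l2_inner_def
    by (intro arg_cong[where f = sqrt] Bochner_Integration.integral_cong)
       (auto simp: space_face_measure)
  then have "l2_norm (face_measure e) g = 0"
    using lim by (simp add: LIMSEQ_const_iff)
  then show ?thesis
    using g by (intro AE_zero_if_l2_inner_self_zero) (auto simp: l2_norm_def)
qed

section \<open>Boundary components of discrete functions\<close>

definition zero_boundary_AE :: "'a::euclidean_space set \<Rightarrow> 'a mesh \<Rightarrow> 'a weak_fun \<Rightarrow> bool" where
  "zero_boundary_AE \<Omega> m v \<longleftrightarrow>
     (\<forall>e\<in>faces m. e \<subseteq> frontier \<Omega> \<longrightarrow>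
        (AE x in face_measure e. vb v e x = 0) \<and> (AE x in face_measure e. vn v e x = 0))"

lemma compact_face: "polyhedral_mesh \<Omega> m \<Longrightarrow> e \<in> faces m \<Longrightarrow> compact e"
  by (auto simp: polyhedral_mesh_def flat_face_def intro!: compact_polyhedral_set)

lemma compact_elem: "polyhedral_mesh \<Omega> m \<Longrightarrow> T \<in> elems m \<Longrightarrow> compact T"
  by (auto simp: polyhedral_mesh_def polyhedral_element_def intro!: compact_polyhedral_set)

lemma Qh_in_Vh: "is_Qh \<Omega> m k u w \<Longrightarrow> w \<in> Vh m k"
  by (auto simp: is_Qh_def Vh_def is_L2_proj_def)

lemma Qh_zero_boundary_AE:
  assumes "is_Qh \<Omega> m k u w" "open \<Omega>" "polyhedral_mesh \<Omega> m"
  shows "zero_boundary_AE \<Omega> m w"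
  unfolding zero_boundary_AE_def
proof (intro ballI impI)
  fix e assume e: "e \<in> faces m" "e \<subseteq> frontier \<Omega>"
  obtain g g' where
    g: "is_trace \<Omega> e [] u g" "is_L2_proj (face_measure e) (poly_on k e) g (vb w e)" and
    g': "is_trace \<Omega> e [fnormal m e] u g'" 
        "is_L2_proj (face_measure e) (poly_on (k - 1) e) g' (vn w e)"
    using assms(1) e by (auto simp: is_Qh_def)
  have "compact e" by (rule compact_face[OF assms(3) e(1)])
  then have L2: "vb w e \<in> L2 (face_measure e)" "vn w e \<in> L2 (face_measure e)"
    using g(2) g'(2) by (auto simp: is_L2_proj_def intro: poly_on_in_L2)
  show "(AE x in face_measure e. vb w e x = 0) \<and> (AE x in face_measure e. vn w e x = 0)"
    using L2_proj_AE_zero[OF g(2) L2(1) _ boundary_trace_AE_zero[OF g(1) assms(2) e(2)]]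
      L2_proj_AE_zero[OF g'(2) L2(2) _ boundary_trace_AE_zero[OF g'(1) assms(2) e(2)]] g(1) g'(1)
    by (auto simp: is_trace_def)
qed

lemma Vh0_zero_boundary_AE: "v \<in> Vh0 \<Omega> m k \<Longrightarrow> zero_boundary_AE \<Omega> m v"
  by (auto simp: Vh0_def zero_boundary_AE_def space_face_measure intro!: AE_I2)

lemma zero_boundary_AE_combination:
  assumes "zero_boundary_AE \<Omega> m v" "zero_boundary_AE \<Omega> m w"
  shows "zero_boundary_AE \<Omega> m (a *\<^sub>R v + b *\<^sub>R w)"
  unfolding zero_boundary_AE_def
proof (intro ballI impI conjI)
  fix e assume "e \<in> faces m" "e \<subseteq> frontier \<Omega>"
  then have *: "AE x in face_measure e. vb v e x = 0" "AE x in face_measure e. vb w e x = 0"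
    "AE x in face_measure e. vn v e x = 0" "AE x in face_measure e. vn w e x = 0"
    using assms by (auto simp: zero_boundary_AE_def)
  show "AE x in face_measure e. vb (a *\<^sub>R v + b *\<^sub>R w) e x = 0"
    using *(1,2) by eventually_elim (simp add: plus_weak_fun_def scaleR_weak_fun_def)
  show "AE x in face_measure e. vn (a *\<^sub>R v + b *\<^sub>R w) e x = 0"
    using *(3,4) by eventually_elim (simp add: plus_weak_fun_def scaleR_weak_fun_def)
qed

lemma Vh_combination:
  assumes "v \<in> Vh m k" "w \<in> Vh m k"
  shows "a *\<^sub>R v + b *\<^sub>R w \<in> Vh m k"
  using assms
  by (auto simp: Vh_def plus_weak_fun_def scaleR_weak_fun_def
      intro!: poly_fun_add poly_fun_scale poly_on_add poly_on_scale)

text \<open>Turns a discrete function whose boundary values vanish almost everywhere into an admissible test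
  function.\<close>

definition reset_boundary :: "'a::euclidean_space set \<Rightarrow> 'a weak_fun \<Rightarrow> 'a weak_fun" where
  "reset_boundary \<Omega> v = Weak_Fun (v0 v)
     (\<lambda>e. if e \<subseteq> frontier \<Omega> then (\<lambda>_. 0) else vb v e)
     (\<lambda>e. if e \<subseteq> frontier \<Omega> then (\<lambda>_. 0) else vn v e)"

lemma reset_boundary_in_Vh0: "v \<in> Vh m k \<Longrightarrow> reset_boundary \<Omega> v \<in> Vh0 \<Omega> m k"
  by (auto simp: Vh0_def Vh_def reset_boundary_def zero_poly_on)

lemma v0_reset_boundary [simp]: "v0 (reset_boundary \<Omega> v) = v0 v"
  by (simp add: reset_boundary_def)

text \<open>The face components enter the definition of the weak Laplacian only through integrals over
  faces, so a change on a null set leaves its defining condition unchanged.\<close>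

lemma weak_laplacian_reset_boundary:
  assumes "zero_boundary_AE \<Omega> m v" "v \<in> Vh m k" "polyhedral_mesh \<Omega> m"
  shows "weak_laplacian m r (reset_boundary \<Omega> v) = weak_laplacian m r v"
proof -
  have b: "l2_inner (face_measure e) (vb (reset_boundary \<Omega> v) e) q = l2_inner (face_measure e) (vb v e) q"
   and n: "l2_inner (face_measure e) (\<lambda>x. (vn (reset_boundary \<Omega> v) e x *\<^sub>R fnormal m e) \<bullet> \<nu>) q
      = l2_inner (face_measure e) (\<lambda>x. (vn v e x *\<^sub>R fnormal m e) \<bullet> \<nu>) q"
    if "e \<in> faces_of m T" for e q \<nu> T
  proof -
    have e: "e \<in> faces m" using that by (simp add: faces_of_def)
    have "compact e" by (rule compact_face[OF assms(3) e])
    then have L2: "vb v e \<in> L2 (face_measure e)" "vn v e \<in> L2 (face_measure e)"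
      using assms(2) e by (auto simp: Vh_def intro: poly_on_in_L2)
    have zero: "AE x in face_measure e. vb v e x = 0" "AE x in face_measure e. vn v e x = 0"
      if "e \<subseteq> frontier \<Omega>"
      using assms(1) e that by (auto simp: zero_boundary_AE_def)
    show "l2_inner (face_measure e) (vb (reset_boundary \<Omega> v) e) q = l2_inner (face_measure e) (vb v e) q"
      using l2_inner_AE_zero[of "vb v e" "face_measure e" q] zero(1) L2
      by (auto simp: reset_boundary_def L2_def) (simp add: l2_inner_def)
    show "l2_inner (face_measure e) (\<lambda>x. (vn (reset_boundary \<Omega> v) e x *\<^sub>R fnormal m e) \<bullet> \<nu>) q
      = l2_inner (face_measure e) (\<lambda>x. (vn v e x *\<^sub>R fnormal m e) \<bullet> \<nu>) q"
      using l2_inner_AE_zero[of "\<lambda>x. vn v e x * (fnormal m e \<bullet> \<nu>)" "face_measure e" q] zero(2) L2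
      by (auto simp: reset_boundary_def L2_def) (simp add: l2_inner_def)
  qed
  show ?thesis
    unfolding weak_laplacian_def by (intro ext) (simp only: b n v0_reset_boundary cong: sum.cong)
qed

section \<open>The elementwise inner product\<close>

definition mesh_L2 :: "'a::euclidean_space mesh \<Rightarrow> ('a set \<Rightarrow> 'a \<Rightarrow> real) set" where
  "mesh_L2 m = {F. \<forall>T\<in>elems m. F T \<in> L2 (lebesgue_on T)}"

definition mesh_norm :: "'a::euclidean_space mesh \<Rightarrow> ('a set \<Rightarrow> 'a \<Rightarrow> real) \<Rightarrow> real" where
  "mesh_norm m F = sqrt (mesh_inner m F F)"

lemma mesh_L2_combination:
  assumes "F \<in> mesh_L2 m" "G \<in> mesh_L2 m"
  shows "(\<lambda>T x. a * F T x + b * G T x) \<in> mesh_L2 m"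
  using assms by (auto simp: mesh_L2_def intro!: L2_add L2_scale)

lemma mesh_inner_combination_left:
  assumes "F \<in> mesh_L2 m" "G \<in> mesh_L2 m" "H \<in> mesh_L2 m"
  shows "mesh_inner m (\<lambda>T x. a * F T x + b * G T x) H = a * mesh_inner m F H + b * mesh_inner m G H"
proof -
  have "l2_inner (lebesgue_on T) (\<lambda>x. a * F T x + b * G T x) (H T)
      = a * l2_inner (lebesgue_on T) (F T) (H T) + b * l2_inner (lebesgue_on T) (G T) (H T)"
    if "T \<in> elems m" for T
  proof -
    have "integrable (lebesgue_on T) (\<lambda>x. F T x * H T x)"
         "integrable (lebesgue_on T) (\<lambda>x. G T x * H T x)"
      using assms that by (auto simp: mesh_L2_def intro!: L2_integrable_mult)
    then show ?thesis by (simp add: l2_inner_def distrib_right mult.assoc)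
  qed
  then show ?thesis
    by (simp add: mesh_inner_def sum.distrib sum_distrib_left)
qed

lemma mesh_inner_commute: "mesh_inner m F G = mesh_inner m G F"
  by (simp add: mesh_inner_def l2_inner_def mult.commute)

lemma mesh_inner_combination_right:
  assumes "F \<in> mesh_L2 m" "G \<in> mesh_L2 m" "H \<in> mesh_L2 m"
  shows "mesh_inner m H (\<lambda>T x. a * F T x + b * G T x) = a * mesh_inner m H F + b * mesh_inner m H G"
  using mesh_inner_combination_left[OF assms] by (simp add: mesh_inner_commute[of m H])

lemma mesh_inner_self_nonneg: "mesh_inner m F F \<ge> 0"
  by (auto simp: mesh_inner_def l2_inner_def intro!: sum_nonneg integral_nonneg)

lemma mesh_norm_nonneg: "mesh_norm m F \<ge> 0"
  by (simp add: mesh_norm_def mesh_inner_self_nonneg)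

lemma mesh_norm_square: "(mesh_norm m F)\<^sup>2 = mesh_inner m F F"
  by (simp add: mesh_norm_def mesh_inner_self_nonneg)

lemma mesh_inner_self_combination:
  assumes "F \<in> mesh_L2 m" "G \<in> mesh_L2 m"
  shows "mesh_inner m (\<lambda>T x. a * F T x + b * G T x) (\<lambda>T x. a * F T x + b * G T x)
    = a\<^sup>2 * (mesh_norm m F)\<^sup>2 + 2 * a * b * mesh_inner m F G + b\<^sup>2 * (mesh_norm m G)\<^sup>2"
  using assms unfolding mesh_norm_square
  by (simp add: mesh_inner_combination_left mesh_inner_combination_right mesh_L2_combination
      mesh_inner_commute[of m G F] power2_eq_square algebra_simps)

text \<open>The usual choice of coefficients in the nonnegative quadratic form \<open>\<parallel>s F + t G\<parallel>\<^sup>2\<close> is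
  \<open>s = \<parallel>G\<parallel>\<close>, \<open>t = - \<parallel>F\<parallel>\<close>; it fails when one of the seminorms is zero. Enlarging both by \<open>\<epsilon> > 0\<close>
  and letting \<open>\<epsilon> \<rightarrow> 0\<close> treats all cases at once.\<close>

lemma mesh_Cauchy_Schwarz:
  assumes "F \<in> mesh_L2 m" "G \<in> mesh_L2 m"
  shows "mesh_inner m F G \<le> mesh_norm m F * mesh_norm m G"
proof -
  let ?a = "mesh_norm m F" and ?b = "mesh_norm m G" and ?c = "mesh_inner m F G"
  have q: "0 \<le> s\<^sup>2 * ?a\<^sup>2 + 2 * s * t * ?c + t\<^sup>2 * ?b\<^sup>2" for s t
    using mesh_inner_self_nonneg[of m "\<lambda>T x. s * F T x + t * G T x"]
    unfolding mesh_inner_self_combination[OF assms] .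
  have "?c \<le> (?a + \<epsilon>) * (?b + \<epsilon>)" if "\<epsilon> > 0" for \<epsilon>
  proof -
    let ?x = "?a + \<epsilon>" and ?y = "?b + \<epsilon>"
    have nonneg: "0 \<le> ?a" "0 \<le> ?b" by (rule mesh_norm_nonneg)+
    have "?a\<^sup>2 \<le> ?x\<^sup>2" "?b\<^sup>2 \<le> ?y\<^sup>2"
      using that nonneg by (auto intro!: power_mono)
    then have "?y\<^sup>2 * ?a\<^sup>2 \<le> ?y\<^sup>2 * ?x\<^sup>2" "?x\<^sup>2 * ?b\<^sup>2 \<le> ?x\<^sup>2 * ?y\<^sup>2"
      by (auto intro: mult_left_mono)
    moreover have "?y\<^sup>2 * ?x\<^sup>2 = (?x * ?y) * (?x * ?y)" "?x\<^sup>2 * ?y\<^sup>2 = (?x * ?y) * (?x * ?y)"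
      by (simp_all add: power2_eq_square)
    moreover have "0 \<le> ?y\<^sup>2 * ?a\<^sup>2 - 2 * ((?x * ?y) * ?c) + ?x\<^sup>2 * ?b\<^sup>2"
    proof -
      have "?y\<^sup>2 * ?a\<^sup>2 + 2 * ?y * (- ?x) * ?c + (- ?x)\<^sup>2 * ?b\<^sup>2
          = ?y\<^sup>2 * ?a\<^sup>2 - 2 * ((?x * ?y) * ?c) + ?x\<^sup>2 * ?b\<^sup>2"
        by (simp only: power2_minus mult_minus_right mult_minus_left mult.assoc
            mult.left_commute[of ?y ?x] diff_conv_add_uminus)
      then show ?thesis using q[of ?y "- ?x"] by simp
    qed
    ultimately have "(?x * ?y) * ?c \<le> (?x * ?y) * (?x * ?y)"
      by linarith
    moreover have "?x * ?y > 0"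
      using that nonneg by (intro mult_pos_pos) auto
    ultimately show ?thesis by (simp only: mult_le_cancel_left_pos)
  qed
  then have "\<forall>\<^sub>F \<epsilon> in at_right 0. ?c \<le> (?a + \<epsilon>) * (?b + \<epsilon>)"
    by (auto simp: eventually_at_right_field intro!: exI[of _ 1])
  moreover have "((\<lambda>\<epsilon>. (?a + \<epsilon>) * (?b + \<epsilon>)) \<longlongrightarrow> (?a + 0) * (?b + 0)) (at_right 0)"
    by (intro tendsto_intros)
  ultimately show ?thesis
    using tendsto_lowerbound[of _ _ "at_right (0::real)" ?c] by fastforce
qed

lemma mesh_norm_combination_le:
  assumes "F \<in> mesh_L2 m" "G \<in> mesh_L2 m" "a \<ge> 0" "b \<ge> 0"
  shows "mesh_norm m (\<lambda>T x. a * F T x + b * G T x) \<le> a * mesh_norm m F + b * mesh_norm m G"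
proof (rule power2_le_imp_le)
  have "2 * a * b * mesh_inner m F G \<le> 2 * a * b * (mesh_norm m F * mesh_norm m G)"
    using mesh_Cauchy_Schwarz[OF assms(1,2)] assms(3,4) by (intro mult_left_mono) auto
  then show "(mesh_norm m (\<lambda>T x. a * F T x + b * G T x))\<^sup>2 \<le> (a * mesh_norm m F + b * mesh_norm m G)\<^sup>2"
    by (simp add: mesh_norm_square[of m "\<lambda>T x. a * F T x + b * G T x"]
        mesh_inner_self_combination[OF assms(1,2)] power2_sum power_mult_distrib algebra_simps)
  show "0 \<le> a * mesh_norm m F + b * mesh_norm m G"
    using assms(3,4) mesh_norm_nonneg[of m] by simp
qed

section \<open>Restricting functions on the domain to the mesh\<close>

text \<open>The domain is the interior of its closure, so it has no slits that an element could cross.\<close>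

lemma elem_interior_subset:
  assumes "polyhedral_domain \<Omega>" "polyhedral_mesh \<Omega> m" "T \<in> elems m"
  shows "interior T \<subseteq> \<Omega>"
proof -
  have "T \<subseteq> closure \<Omega>" using assms by (auto simp: polyhedral_mesh_def)
  then have "interior T \<subseteq> interior (closure \<Omega>)" by (rule interior_mono)
  then show ?thesis using assms(1) by (simp add: polyhedral_domain_def)
qed

text \<open>Membership passes from the interior to the closed set because Lebesgue measure is complete: the
  values on the null boundary, where \<open>g\<close> may be arbitrary, cannot destroy measurability.\<close>

lemma L2_interior:
  fixes g :: "'a::euclidean_space \<Rightarrow> real"
  assumes "negligible (frontier T)" "closed T" "g \<in> L2 (lebesgue_on (interior T))"
  shows "g \<in> L2 (lebesgue_on T)"
    and "l2_inner (lebesgue_on T) g g = l2_inner (lebesgue_on (interior T)) g g"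
proof -
  have sets: "T \<in> sets lebesgue" "interior T \<in> sets lebesgue" using assms(2) by auto
  have "interior T - T = {}" "T - interior T = frontier T"
    using interior_subset assms(2) by (auto simp: frontier_def)
  then have null: "negligible ((interior T - T) \<union> (T - interior T))"
    "negligible {x \<in> interior T - T. q x \<noteq> 0}" "negligible {x \<in> T - interior T. q x \<noteq> 0}"
    for q :: "'a \<Rightarrow> real"
    using assms(1) by (auto intro: negligible_subset)
  let ?h = "\<lambda>x. if x \<in> interior T then g x else 0"
  have "?h \<in> borel_measurable lebesgue"
    using assms(3) borel_measurable_if[OF sets(2), of g] by (simp add: L2_def)
  then have "?h measurable_on UNIV"
    by (rule lebesgue_measurable_imp_measurable_on_real) simp
  then have "g measurable_on interior T" by (simp only: measurable_on_UNIV)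
  then have "g measurable_on T" by (rule measurable_on_spike_set[OF _ null(1)])
  then have meas: "g \<in> borel_measurable (lebesgue_on T)"
    by (rule measurable_on_imp_borel_measurable_lebesgue[OF _ sets(1)])
  have int: "integrable (lebesgue_on (interior T)) (\<lambda>x. (g x)\<^sup>2)"
    using assms(3) by (simp add: L2_def)
  then have "(\<lambda>x. (g x)\<^sup>2) absolutely_integrable_on interior T"
    using sets by (simp add: integrable_restrict_space set_integrable_def)
  then have "(\<lambda>x. (g x)\<^sup>2) absolutely_integrable_on T"
    using absolutely_integrable_spike_set_eq[OF null(2,3)] by blast
  then have int': "integrable (lebesgue_on T) (\<lambda>x. (g x)\<^sup>2)"
    using sets by (simp add: integrable_restrict_space set_integrable_def)
  show "g \<in> L2 (lebesgue_on T)"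
    using meas int' by (simp add: L2_def)
  show "l2_inner (lebesgue_on T) g g = l2_inner (lebesgue_on (interior T)) g g"
    using lebesgue_integral_eq_integral[OF int sets(2)] lebesgue_integral_eq_integral[OF int' sets(1)]
      integral_spike_set[OF null(2,3), of "\<lambda>x. (g x)\<^sup>2"]
    by (simp add: l2_inner_def power2_eq_square)
qed

text \<open>The interiors of the elements are disjoint subsets of the domain, and each carries the whole
  integral over its element.\<close>

lemma L2_restrict_mesh:
  fixes \<Omega> :: "'a::euclidean_space set"
  assumes \<Omega>: "polyhedral_domain \<Omega>" and m: "polyhedral_mesh \<Omega> m" and g: "g \<in> L2 (lebesgue_on \<Omega>)"
  shows "(\<lambda>T. g) \<in> mesh_L2 m" "mesh_norm m (\<lambda>T. g) \<le> l2_norm (lebesgue_on \<Omega>) g"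
proof -
  have set\<Omega>: "\<Omega> \<in> sets lebesgue" using \<Omega> by (auto simp: polyhedral_domain_def)
  let ?q = "\<lambda>x. (g x)\<^sup>2"
  have q\<Omega>: "set_integrable lebesgue \<Omega> ?q"
    using g set\<Omega> by (simp add: L2_def integrable_restrict_space set_integrable_def)
  have elem: "negligible (frontier T)" "closed T" "interior T \<subseteq> \<Omega>" if "T \<in> elems m" for T
  proof -
    have "polyhedral_set T"
      using that m by (simp add: polyhedral_mesh_def polyhedral_element_def)
    then show "negligible (frontier T)" "closed T"
      using negligible_frontier_polyhedral_set compact_polyhedral_set compact_imp_closed by blast+
    show "interior T \<subseteq> \<Omega>" by (rule elem_interior_subset[OF \<Omega> m that])
  qed
  have qT: "set_integrable lebesgue (interior T) ?q" if "T \<in> elems m" for T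
    by (rule set_integrable_subset[OF q\<Omega> _ elem(3)[OF that]]) auto
  have L2: "g \<in> L2 (lebesgue_on (interior T))" if "T \<in> elems m" for T
  proof -
    have "g \<in> borel_measurable (lebesgue_on (interior T))"
    proof (rule measurable_restrict_mono[OF _ elem(3)[OF that]])
      show "g \<in> borel_measurable (lebesgue_on \<Omega>)" using g by (simp add: L2_def)
    qed
    then show ?thesis
      using qT[OF that] by (simp add: L2_def integrable_restrict_space set_integrable_def)
  qed
  show "(\<lambda>T. g) \<in> mesh_L2 m"
    unfolding mesh_L2_def using L2_interior(1)[OF elem(1,2) L2] by simp
  have disj: "disjoint_family_on interior (elems m)"
    using m by (auto simp: polyhedral_mesh_def disjoint_family_on_def)
  have fin: "finite (elems m)" using m by (simp add: polyhedral_mesh_def)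
  have "mesh_inner m (\<lambda>T. g) (\<lambda>T. g) = (\<Sum>T\<in>elems m. LINT x:interior T|lebesgue. ?q x)"
    unfolding mesh_inner_def
  proof (rule sum.cong[OF refl])
    fix T assume T: "T \<in> elems m"
    show "l2_inner (lebesgue_on T) g g = (LINT x:interior T|lebesgue. ?q x)"
      unfolding L2_interior(2)[OF elem(1,2)[OF T] L2[OF T]]
      by (simp add: l2_inner_def power2_eq_square
          integral_restrict_space set_lebesgue_integral_def)
  qed
  also have "\<dots> = (LINT x:(\<Union>T\<in>elems m. interior T)|lebesgue. ?q x)"
    by (rule set_integral_finite_Union[symmetric, OF fin disj qT]) auto
  also have "\<dots> \<le> (LINT x:\<Omega>|lebesgue. ?q x)"
    unfolding set_lebesgue_integral_def
  proof (rule integral_mono)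
    show "integrable lebesgue (\<lambda>x. indicat_real (\<Union>T\<in>elems m. interior T) x *\<^sub>R ?q x)"
      using set_integrable_UN[OF fin qT] by (simp add: set_integrable_def)
    show "integrable lebesgue (\<lambda>x. indicat_real \<Omega> x *\<^sub>R ?q x)"
      using q\<Omega> by (simp add: set_integrable_def)
    show "indicat_real (\<Union>T\<in>elems m. interior T) x *\<^sub>R ?q x \<le> indicat_real \<Omega> x *\<^sub>R ?q x" for x
      using elem(3) by (auto simp: indicator_def)
  qed
  also have "\<dots> = l2_inner (lebesgue_on \<Omega>) g g"
    using set\<Omega> by (simp add: l2_inner_def power2_eq_square integral_restrict_space
        set_lebesgue_integral_def)
  finally show "mesh_norm m (\<lambda>T. g) \<le> l2_norm (lebesgue_on \<Omega>) g"
    by (simp add: mesh_norm_def l2_norm_def)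
qed

section \<open>Stability\<close>

text \<open>One time step. The hypothesis \<open>energy\<close> is the scheme tested with the average of the two time
  levels, after the stiffness term has been dropped.\<close>

lemma theta_step:
  assumes U: "U \<in> mesh_L2 m" and V: "V \<in> mesh_L2 m" and F: "F \<in> mesh_L2 m"
    and \<theta>: "1/2 \<le> \<theta>" "\<theta> \<le> 1" and "\<tau> > 0" and M: "mesh_norm m F \<le> M"
    and energy: "mesh_inner m (\<lambda>T x. (1 / \<tau>) * U T x + (- 1 / \<tau>) * V T x)
        (\<lambda>T x. \<theta> * U T x + (1 - \<theta>) * V T x)
      \<le> mesh_inner m F (\<lambda>T x. \<theta> * U T x + (1 - \<theta>) * V T x)"
  shows "mesh_norm m U \<le> mesh_norm m V + \<tau> * M"
proof -
  let ?W = "\<lambda>T x. \<theta> * U T x + (1 - \<theta>) * V T x"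
  define a b c s where abc: "a = mesh_norm m U" "b = mesh_norm m V" "c = mesh_inner m U V"
    "s = \<theta> * a + (1 - \<theta>) * b"
  have ab: "0 \<le> a" "0 \<le> b" "c \<le> a * b"
    using mesh_norm_nonneg mesh_Cauchy_Schwarz[OF U V] by (auto simp: abc)
  have M0: "0 \<le> M" using mesh_norm_nonneg[of m F] M by linarith
  have "mesh_inner m (\<lambda>T x. (1 / \<tau>) * U T x + (- 1 / \<tau>) * V T x) ?W
     = (1 / \<tau>) * (\<theta> * a\<^sup>2 - (2 * \<theta> - 1) * c - (1 - \<theta>) * b\<^sup>2)"
    unfolding mesh_inner_combination_left[OF U V mesh_L2_combination[OF U V]]
      mesh_inner_combination_right[OF U V U] mesh_inner_combination_right[OF U V V]
      mesh_inner_commute[of m V U] abc mesh_norm_square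
    by (simp add: diff_divide_distrib add_divide_distrib algebra_simps)
  moreover have "(1 / \<tau>) * (\<theta> * a\<^sup>2 - (2 * \<theta> - 1) * (a * b) - (1 - \<theta>) * b\<^sup>2)
     \<le> (1 / \<tau>) * (\<theta> * a\<^sup>2 - (2 * \<theta> - 1) * c - (1 - \<theta>) * b\<^sup>2)"
    (* 2 * theta - 1 is nonnegative: this is where the restriction on theta enters *)
    using ab \<theta> \<open>\<tau> > 0\<close> by (intro mult_left_mono diff_right_mono diff_left_mono) auto
  moreover have "\<theta> * a\<^sup>2 - (2 * \<theta> - 1) * (a * b) - (1 - \<theta>) * b\<^sup>2 = (a - b) * s"
    by (simp add: abc(4) power2_eq_square algebra_simps)
  moreover have "mesh_inner m F ?W \<le> M * s"
  proof -
    have "mesh_norm m ?W \<le> s"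
      using mesh_norm_combination_le[OF U V, of \<theta> "1 - \<theta>"] \<theta> by (simp add: abc)
    then have "mesh_norm m F * mesh_norm m ?W \<le> M * s"
      using M M0 mesh_norm_nonneg[of m ?W] by (intro mult_mono) auto
    then show ?thesis
      using mesh_Cauchy_Schwarz[OF F mesh_L2_combination[OF U V]] by (rule order_trans[rotated])
  qed
  ultimately have main: "(1 / \<tau>) * ((a - b) * s) \<le> M * s"
    using energy by simp
  show ?thesis
  proof (cases "s = 0")
    (* the factor s cannot be cancelled, but then a = 0 because theta is positive *)
    case True
    have "0 \<le> \<theta> * a" "0 \<le> (1 - \<theta>) * b" using ab \<theta> by auto
    then have "\<theta> * a = 0" using True abc(4) by linarith
    then have "a = 0" using \<theta> by auto
    then show ?thesis using ab M0 \<open>\<tau> > 0\<close> abc by simp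
  next
    case False
    then have "s > 0" using ab \<theta> by (simp add: abc(4) less_le)
    moreover have "(a - b) / \<tau> * s \<le> M * s" using main by simp
    ultimately have "(a - b) / \<tau> \<le> M" by (simp only: mult_le_cancel_right_pos)
    then show ?thesis using \<open>\<tau> > 0\<close> by (simp add: abc field_simps)
  qed
qed

lemma Vh_v0_mesh_L2: "polyhedral_mesh \<Omega> m \<Longrightarrow> v \<in> Vh m k \<Longrightarrow> v0 v \<in> mesh_L2 m"
  by (auto simp: mesh_L2_def Vh_def intro: poly_fun_in_L2 compact_elem)

lemma theta_scheme_stable:
  fixes \<Omega> :: "'a::euclidean_space set"
  assumes \<Omega>: "polyhedral_domain \<Omega>" and m: "polyhedral_mesh \<Omega> m"
    and \<theta>: "1/2 \<le> \<theta>" "\<theta> \<le> 1" and "\<tau> > 0"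
    and f: "\<And>j. j \<le> N \<Longrightarrow> f (real j * \<tau>) \<in> L2 (lebesgue_on \<Omega>)"
    and M: "\<And>j. j \<le> N \<Longrightarrow> l2_norm (lebesgue_on \<Omega>) (f (real j * \<tau>)) \<le> M"
    and scheme: "theta_scheme \<Omega> m k r \<theta> \<tau> N f \<psi> U"
    and "n \<le> N"
  shows "weak_norm m (U n) \<le> weak_norm m (U 0) + real n * \<tau> * M"
  using \<open>n \<le> N\<close>
proof (induction n)
  case 0
  then show ?case by simp
next
  case (Suc n)
  have U: "U j \<in> Vh m k \<and> zero_boundary_AE \<Omega> m (U j)" if "j \<le> N" for j
  proof (cases "j = 0")
    case True
    have "is_Qh \<Omega> m k \<psi> (U 0)" using scheme by (simp add: theta_scheme_def)
    then show ?thesis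
      using True Qh_in_Vh[of \<Omega> m k \<psi> "U 0"] Qh_zero_boundary_AE[of \<Omega> m k \<psi> "U 0", OF _ _ m] \<Omega>
      by (auto simp: polyhedral_domain_def)
  next
    case False
    then have "U j \<in> Vh0 \<Omega> m k" using scheme that by (simp add: theta_scheme_def)
    then show ?thesis using Vh0_zero_boundary_AE by (auto simp: Vh0_def)
  qed
  let ?W = "\<theta> *\<^sub>R U (Suc n) + (1 - \<theta>) *\<^sub>R U n"
  let ?F = "\<lambda>(T :: 'a set) x. \<theta> * f (real (Suc n) * \<tau>) x + (1 - \<theta>) * f (real n * \<tau>) x"
  have W: "?W \<in> Vh m k" "zero_boundary_AE \<Omega> m ?W"
    using U Suc.prems by (auto intro!: Vh_combination zero_boundary_AE_combination)
  have step: "\<forall>v\<in>Vh0 \<Omega> m k.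
           mesh_inner m (v0 (backward_diff \<tau> U (Suc n))) (v0 v)
           + mesh_inner m (weak_laplacian m r ?W) (weak_laplacian m r v) = mesh_inner m ?F (v0 v)"
    using scheme Suc.prems by (force simp: theta_scheme_def)
  have "mesh_inner m (v0 (backward_diff \<tau> U (Suc n))) (v0 ?W)
      + mesh_inner m (weak_laplacian m r ?W) (weak_laplacian m r ?W) = mesh_inner m ?F (v0 ?W)"
    using bspec[OF step reset_boundary_in_Vh0[OF W(1)]]
      weak_laplacian_reset_boundary[OF W(2,1) m] by simp
  then have "mesh_inner m (v0 (backward_diff \<tau> U (Suc n))) (v0 ?W) \<le> mesh_inner m ?F (v0 ?W)"
    using mesh_inner_self_nonneg[of m "weak_laplacian m r ?W"] by linarith
  moreover have "v0 (backward_diff \<tau> U (Suc n))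
      = (\<lambda>T x. (1 / \<tau>) * v0 (U (Suc n)) T x + (- 1 / \<tau>) * v0 (U n) T x)"
    by (auto simp: backward_diff_def minus_weak_fun_def scaleR_weak_fun_def fun_eq_iff diff_divide_distrib)
  moreover have "v0 ?W = (\<lambda>T x. \<theta> * v0 (U (Suc n)) T x + (1 - \<theta>) * v0 (U n) T x)"
    by (simp add: plus_weak_fun_def scaleR_weak_fun_def)
  ultimately have energy: "mesh_inner m
       (\<lambda>T x. (1 / \<tau>) * v0 (U (Suc n)) T x + (- 1 / \<tau>) * v0 (U n) T x)
       (\<lambda>T x. \<theta> * v0 (U (Suc n)) T x + (1 - \<theta>) * v0 (U n) T x)
     \<le> mesh_inner m ?F (\<lambda>T x. \<theta> * v0 (U (Suc n)) T x + (1 - \<theta>) * v0 (U n) T x)"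
    by simp
  have fn: "(\<lambda>T. f (real j * \<tau>)) \<in> mesh_L2 m" "mesh_norm m (\<lambda>T. f (real j * \<tau>)) \<le> M"
    if "j \<le> N" for j
    using L2_restrict_mesh[OF \<Omega> m f[OF that]] M[OF that] by auto
  have F: "?F \<in> mesh_L2 m"
    using Suc.prems by (intro mesh_L2_combination fn) auto
  have "mesh_norm m ?F \<le> \<theta> * mesh_norm m (\<lambda>T. f (real (Suc n) * \<tau>))
      + (1 - \<theta>) * mesh_norm m (\<lambda>T. f (real n * \<tau>))"
    using Suc.prems \<theta> by (intro mesh_norm_combination_le fn) auto
  also have "\<dots> \<le> \<theta> * M + (1 - \<theta>) * M"
    using Suc.prems \<theta> by (intro add_mono mult_left_mono fn) auto
  finally have FM: "mesh_norm m ?F \<le> M" by (simp add: algebra_simps)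
  have "mesh_norm m (v0 (U (Suc n))) \<le> mesh_norm m (v0 (U n)) + \<tau> * M"
    using U[of n] U[of "Suc n"] Suc.prems Vh_v0_mesh_L2[OF m, of _ k]
    by (intro theta_step[OF _ _ F \<theta> \<open>\<tau> > 0\<close> FM energy]) simp_all
  then show ?case
    using Suc by (simp add: weak_norm_def mesh_norm_def algebra_simps)
qed

theorem theorem3p10:
  fixes \<Omega> :: "'a::euclidean_space set"
    and tbar \<theta> C1 C2 \<rho>v \<rho>e \<kappa> \<sigma> \<gamma> \<eta> :: real
    and k r L :: nat
  assumes "DIM('a) = 2 \<or> DIM('a) = 3"
    and "polyhedral_domain \<Omega>"
    and "tbar > 0"
    and "k \<ge> 2"
    and "\<rho>v > 0" "\<rho>e > 0" "\<kappa> > 0" "\<sigma> > 0" "\<gamma> > 0" "\<eta> > 0"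
    and "C1 > 0" "C2 > 0"
    and "\<theta> \<in> {1/2..1}"
  shows "\<exists>C>0. \<forall>(m :: 'a mesh) (\<tau> :: real) (N :: nat)
            (f :: real \<Rightarrow> 'a \<Rightarrow> real) (\<psi> :: 'a \<Rightarrow> real) (U :: nat \<Rightarrow> 'a weak_fun).
           polyhedral_mesh \<Omega> m \<longrightarrow>
           shape_regular \<rho>v \<rho>e \<kappa> \<sigma> \<gamma> \<eta> L m \<longrightarrow>
           norm_equivalence C1 C2 k r m \<longrightarrow>
           \<tau> > 0 \<longrightarrow> real N * \<tau> = tbar \<longrightarrow>
           (\<forall>t\<in>{0..tbar}. f t \<in> L2 (lebesgue_on \<Omega>)) \<longrightarrow>
           bdd_above ((\<lambda>t. l2_norm (lebesgue_on \<Omega>) (f t)) ` {0..tbar}) \<longrightarrow>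
           \<psi> \<in> H02 \<Omega> \<longrightarrow>
           theta_scheme \<Omega> m k r \<theta> \<tau> N f \<psi> U \<longrightarrow>
           (\<forall>n\<in>{1..N}. weak_norm m (U n)
              \<le> weak_norm m (U 0) + C * (SUP t\<in>{0..tbar}. l2_norm (lebesgue_on \<Omega>) (f t)))"


proof (intro exI[of _ tbar] conjI allI impI ballI)
  show "tbar > 0" by fact
  fix m :: "'a mesh" and \<tau> :: real and N :: nat and f :: "real \<Rightarrow> 'a \<Rightarrow> real"
    and \<psi> :: "'a \<Rightarrow> real" and U :: "nat \<Rightarrow> 'a weak_fun" and n :: nat
  assume m: "polyhedral_mesh \<Omega> m" and \<tau>: "\<tau> > 0" "real N * \<tau> = tbar"
    and f: "\<forall>t\<in>{0..tbar}. f t \<in> L2 (lebesgue_on \<Omega>)"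
    and bdd: "bdd_above ((\<lambda>t. l2_norm (lebesgue_on \<Omega>) (f t)) ` {0..tbar})"
    and scheme: "theta_scheme \<Omega> m k r \<theta> \<tau> N f \<psi> U" and n: "n \<in> {1..N}"
  define M where "M = (SUP t\<in>{0..tbar}. l2_norm (lebesgue_on \<Omega>) (f t))"
  have time: "real j * \<tau> \<in> {0..tbar}" if "j \<le> N" for j
    using that \<tau> by (auto intro!: mult_right_mono simp flip: \<tau>(2))
  have sup: "l2_norm (lebesgue_on \<Omega>) (f t) \<le> M" if "t \<in> {0..tbar}" for t
    unfolding M_def by (rule cSUP_upper[OF that bdd])
  have "0 \<le> l2_norm (lebesgue_on \<Omega>) (f 0)"
    by (auto simp: l2_norm_def l2_inner_def intro!: integral_nonneg)
  then have "0 \<le> M" using sup[of 0] \<open>tbar > 0\<close> by simp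
  have "weak_norm m (U n) \<le> weak_norm m (U 0) + real n * \<tau> * M"
    by (rule theta_scheme_stable[OF \<open>polyhedral_domain \<Omega>\<close> m _ _ \<tau>(1) _ _ scheme])
       (use \<open>\<theta> \<in> {1/2..1}\<close> f time sup n in auto)
  also have "\<dots> \<le> weak_norm m (U 0) + tbar * M"
    using time[of n] n \<open>0 \<le> M\<close> by (auto intro!: mult_right_mono)
  finally show "weak_norm m (U n)
      \<le> weak_norm m (U 0) + tbar * (SUP t\<in>{0..tbar}. l2_norm (lebesgue_on \<Omega>) (f t))"
    by (simp add: M_def)
qed

end
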